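(* Let $n,k$ be nonnegative integers. For $1\le i\le n-k$, the number of partial permutations $\pi\in\mathfrak{P}_{n,k}$ with $i$ excedances equals the number of partial permutations in $\mathfrak{P}_{n,k}$ with $n-k-i$ weak excedances. Namely, if $$f_n^{(k)}(q)=\sum_{\pi\in \mathfrak{P}_{n,k}}q^{\mathsf{exc}(\pi)}\quad\text{and}\quad g_n^{(k)}(q)=\sum_{\pi\in \mathfrak{P}_{n,k}}q^{\mathsf{wex}(\pi)},$$ then for $1\le i\le n-k$ we have $$[q^i]f_n^{(k)}(q)=[q^{n-k-i}]g_n^{(k)}(q),$$ where $[q^m]h(q)$ denotes the coefficient of $q^m$ in $h(q)$.
   Context: A partial permutation of order $n$ is an $n\times n$ $(0,1)$-matrix $\pi=(\pi_{i,j})$ with at most one $1$ in each row and each column; $\mathfrak{P}_{n,k}$ is the set of those with exactly $k$ zero rows. $\mathsf{exc}(\pi)$ is the number of excedances, i.e. of indices $i$ such that $\pi_{i,j}=1$ for some $j>i$; $\mathsf{wex}(\pi)$ is the number of weak excedances, i.e. of indices $i$ such that $\pi_{i,j}=1$ for some $j\ge i$. *)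

theory Defs
  imports "Jordan_Normal_Form.Matrix" "HOL-Computational_Algebra.Polynomial"
begin

text \<open>Rows and columns of matrices are indexed by \<open>0, \<dots>, n - 1\<close>; the shift from \<open>1, \<dots>, n\<close>
  does not affect comparisons between row and column indices.\<close>

definition zero_rows :: "nat mat \<Rightarrow> nat set" where
  "zero_rows A = {i. i < dim_row A \<and> row A i = 0\<^sub>v (dim_col A)}"

definition partial_permutation :: "nat \<Rightarrow> nat mat \<Rightarrow> bool" where
  "partial_permutation n A \<longleftrightarrow>
     A \<in> carrier_mat n n \<and>
     (\<forall>i<n. \<forall>j<n. A $$ (i, j) \<in> {0, 1}) \<and>
     (\<forall>i<n. card {j. j < n \<and> A $$ (i, j) = 1} \<le> 1) \<and>
     (\<forall>j<n. card {i. i < n \<and> A $$ (i, j) = 1} \<le> 1)"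

definition partial_perms :: "nat \<Rightarrow> nat \<Rightarrow> nat mat set" where
  "partial_perms n k = {A. partial_permutation n A \<and> card (zero_rows A) = k}"

definition exc :: "nat mat \<Rightarrow> nat" where
  "exc A = card {i. i < dim_row A \<and> (\<exists>j<dim_col A. i < j \<and> A $$ (i, j) = 1)}"

definition wex :: "nat mat \<Rightarrow> nat" where
  "wex A = card {i. i < dim_row A \<and> (\<exists>j<dim_col A. i \<le> j \<and> A $$ (i, j) = 1)}"

definition exc_poly :: "nat \<Rightarrow> nat \<Rightarrow> int poly" where
  "exc_poly n k = (\<Sum>A\<in>partial_perms n k. monom 1 (exc A))"

definition wex_poly :: "nat \<Rightarrow> nat \<Rightarrow> int poly" where
  "wex_poly n k = (\<Sum>A\<in>partial_perms n k. monom 1 (wex A))"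

text \<open>The cardinalities and sums above are over finite sets, so no junk value of
  \<^const>\<open>card\<close> or \<^const>\<open>sum\<close> is involved.\<close>

lemma finite_partial_perms: "finite (partial_perms n k)"
proof (rule finite_subset)
  let ?F = "({..<n} \<times> {..<n}) \<rightarrow>\<^sub>E {0, 1::nat}"
  show "partial_perms n k \<subseteq> mat n n ` ?F"
  proof
    fix A assume A: "A \<in> partial_perms n k"
    let ?f = "restrict (\<lambda>p. A $$ p) ({..<n} \<times> {..<n})"
    have entry: "A $$ (i, j) \<in> {0, 1}" if "i < n" "j < n" for i j
      using A that unfolding partial_perms_def partial_permutation_def by blast
    have "?f \<in> ?F"
    proof (rule PiE_I)
      fix p assume p: "p \<in> {..<n} \<times> {..<n}"
      then have "A $$ (fst p, snd p) \<in> {0, 1}"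
        by (intro entry) (simp_all add: mem_Times_iff)
      with p show "?f p \<in> {0, 1}" by simp
    qed (simp only: restrict_apply if_False)
    moreover have "A = mat n n ?f"
      using A by (intro eq_matI) (auto simp: partial_perms_def partial_permutation_def)
    ultimately show "A \<in> mat n n ` ?F" by (rule rev_image_eqI[where f = "mat n n"])
  qed
  show "finite (mat n n ` ?F)"
    by (intro finite_imageI finite_PiE) auto
qed

end

theory Submission
  imports Defs
begin

text \<open>Transposition preserves the number \<open>n - k\<close> of ones of a partial permutation and sends the
  strict excedances of \<open>\<pi>\<^sup>T\<close> to the ones of \<open>\<pi>\<close> strictly below the diagonal. The remaining
  ones are the weak excedances of \<open>\<pi>\<close>, so \<open>wex \<pi> + exc \<pi>\<^sup>T = n - k\<close>.\<close>

text \<open>\<open>exc\<close>, \<open>wex\<close> and \<open>zero_rows\<close> all concern row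
  indices, which transposition does not preserve. Positions of ones are just swapped by it, so every
  count is moved to this set.\<close>

definition ones :: "nat mat \<Rightarrow> (nat \<times> nat) set" where
  "ones A = {(r, c). r < dim_row A \<and> c < dim_col A \<and> A $$ (r, c) = 1}"

lemma finite_ones: "finite (ones A)"
  by (rule finite_subset[of _ "{..<dim_row A} \<times> {..<dim_col A}"]) (auto simp: ones_def)

lemma ones_transpose: "ones (transpose_mat A) = prod.swap ` ones A"
proof -
  have "x \<in> ones (transpose_mat A) \<longleftrightarrow> prod.swap x \<in> ones A" for x
    by (cases x) (auto simp: ones_def)
  moreover have "x \<in> prod.swap ` ones A \<longleftrightarrow> prod.swap x \<in> ones A" for x
    by (metis image_iff swap_swap)
  ultimately show ?thesis
    by blast
qed

lemma partial_permutation_carrier: "partial_permutation n A \<Longrightarrow> A \<in> carrier_mat n n"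
  by (simp add: partial_permutation_def)

lemma partial_permutation_transpose:
  assumes "partial_permutation n A"
  shows "partial_permutation n (transpose_mat A)"
proof -
  have A: "A \<in> carrier_mat n n"
    using assms by (rule partial_permutation_carrier)
  then have entry: "transpose_mat A $$ (i, j) = A $$ (j, i)" if "i < n" "j < n" for i j
    using that by simp
  have "{j. j < n \<and> transpose_mat A $$ (i, j) = 1} = {j. j < n \<and> A $$ (j, i) = 1}"
    "{j. j < n \<and> transpose_mat A $$ (j, i) = 1} = {j. j < n \<and> A $$ (i, j) = 1}"
    if "i < n" for i
    using entry that by (metis, metis)
  with assms A entry show ?thesis
    unfolding partial_permutation_def by simp
qed

text \<open>Two ones with the same first coordinate would violate the row condition. Hence counting
  rows that contain a suitable one amounts to counting the ones themselves.\<close>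

lemma inj_on_fst_ones:
  assumes "partial_permutation n A"
  shows "inj_on fst (ones A)"
proof (rule inj_onI, clarsimp simp: ones_def)
  \<comment> \<open>\<open>clarsimp\<close> has rewritten the natural number \<open>1\<close> to
    \<open>Suc 0\<close>.\<close>
  fix r c d
  assume *: "r < dim_row A" "c < dim_col A" "d < dim_col A"
    "A $$ (r, c) = Suc 0" "A $$ (r, d) = Suc 0"
  have dims: "dim_row A = n" "dim_col A = n"
    using partial_permutation_carrier[OF assms] by auto
  then have "card {j. j < n \<and> A $$ (r, j) = 1} \<le> Suc 0"
    using assms * by (simp add: partial_permutation_def)
  then have "\<forall>x\<in>{j. j < n \<and> A $$ (r, j) = 1}. \<forall>y\<in>{j. j < n \<and> A $$ (r, j) = 1}. x = y"
    by (subst (asm) card_le_Suc0_iff_eq) auto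
  then show "c = d"
    using * dims by auto
qed

lemma exc_eq_card_ones:
  assumes "partial_permutation n A"
  shows "exc A = card {p \<in> ones A. fst p < snd p}"
proof -
  have "{i. i < dim_row A \<and> (\<exists>j<dim_col A. i < j \<and> A $$ (i, j) = 1)}
      = fst ` {p \<in> ones A. fst p < snd p}"
    by (force simp: ones_def)
  then show ?thesis
    unfolding exc_def
    using inj_on_subset[OF inj_on_fst_ones[OF assms]] by (simp add: card_image)
qed

lemma wex_eq_card_ones:
  assumes "partial_permutation n A"
  shows "wex A = card {p \<in> ones A. fst p \<le> snd p}"
proof -
  have "{i. i < dim_row A \<and> (\<exists>j<dim_col A. i \<le> j \<and> A $$ (i, j) = 1)}
      = fst ` {p \<in> ones A. fst p \<le> snd p}"
    by (force simp: ones_def)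
  then show ?thesis
    unfolding wex_def
    using inj_on_subset[OF inj_on_fst_ones[OF assms]] by (simp add: card_image)
qed

lemma card_ones_add_zero_rows:
  assumes "partial_permutation n A"
  shows "card (ones A) + card (zero_rows A) = n"
proof -
  have dims: "dim_row A = n" "dim_col A = n"
    using partial_permutation_carrier[OF assms] by auto
  have entry: "A $$ (r, c) = 0 \<or> A $$ (r, c) = 1" if "r < n" "c < n" for r c
    using assms that by (auto simp: partial_permutation_def)
  have zero: "zero_rows A = {r. r < n \<and> (\<forall>c<n. A $$ (r, c) = 0)}"
    unfolding zero_rows_def dims by (auto simp: vec_eq_iff dims)
  \<comment> \<open>As entries are 0 or 1, a row that is not zero must contain a one.\<close>
  have "fst ` ones A = {..<n} - zero_rows A"
    unfolding zero ones_def dims using entry by (force simp: image_iff)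
  then have "card (ones A) = card ({..<n} - zero_rows A)"
    using card_image[OF inj_on_fst_ones[OF assms]] by simp
  moreover have "zero_rows A \<subseteq> {..<n}"
    unfolding zero by auto
  ultimately show ?thesis
    using card_mono[of "{..<n}" "zero_rows A"]
    by (simp add: card_Diff_subset finite_subset)
qed

lemma wex_add_exc_transpose:
  assumes "partial_permutation n A"
  shows "wex A + exc (transpose_mat A) = card (ones A)"
proof -
  have "{p \<in> ones (transpose_mat A). fst p < snd p}
      = prod.swap ` {p \<in> ones A. snd p < fst p}"
    by (auto simp: ones_transpose)
  then have "exc (transpose_mat A) = card {p \<in> ones A. snd p < fst p}"
    using exc_eq_card_ones[OF partial_permutation_transpose[OF assms]]
    by (simp add: card_image)
  then have "wex A + exc (transpose_mat A)
      = card ({p \<in> ones A. fst p \<le> snd p} \<union> {p \<in> ones A. snd p < fst p})"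
    using finite_ones[of A]
    by (subst card_Un_disjoint) (auto simp: wex_eq_card_ones[OF assms])
  also have "{p \<in> ones A. fst p \<le> snd p} \<union> {p \<in> ones A. snd p < fst p} = ones A"
    by auto
  finally show ?thesis .
qed

text \<open>The zero rows of the transpose are the zero columns of \<open>A\<close>, a different
  set. Its size is still \<open>k\<close>, because both matrices have equally many ones and this
  number determines the number of zero rows.\<close>

lemma transpose_partial_perms:
  assumes "A \<in> partial_perms n k"
  shows "transpose_mat A \<in> partial_perms n k"
proof -
  have A: "partial_permutation n A" and k: "card (zero_rows A) = k"
    using assms by (auto simp: partial_perms_def)
  note At = partial_permutation_transpose[OF A]
  have "card (ones (transpose_mat A)) = card (ones A)"
    by (simp add: ones_transpose card_image)
  then show ?thesis
    using At k card_ones_add_zero_rows[OF A] card_ones_add_zero_rows[OF At]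
    by (simp add: partial_perms_def)
qed

text \<open>The subtraction is not truncated: the ones and the \<open>k\<close> zero rows together
  number \<open>n\<close>, so \<open>k \<le> n\<close>.\<close>

lemma wex_add_exc_transpose_partial_perms:
  assumes "A \<in> partial_perms n k"
  shows "wex A + exc (transpose_mat A) = n - k"
  using assms wex_add_exc_transpose[of n A] card_ones_add_zero_rows[of n A]
  by (auto simp: partial_perms_def)

text \<open>Transposition is an involution, so it serves as its own inverse and only the two
  inclusions need an argument.\<close>

lemma card_exc_eq_card_wex:
  assumes "i \<le> n - k"
  shows "card {A \<in> partial_perms n k. exc A = i}
       = card {A \<in> partial_perms n k. wex A = n - k - i}"
proof (rule bij_betw_same_card[of transpose_mat], rule bij_betw_byWitness[of _ transpose_mat])
  \<comment> \<open>This is the sum formula for the transpose of \<open>A\<close>, whose own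
    transpose is \<open>A\<close> again.\<close>
  have "wex (transpose_mat A) + exc A = n - k" if "A \<in> partial_perms n k" for A
    using wex_add_exc_transpose_partial_perms[OF transpose_partial_perms[OF that]] by simp
  then show "transpose_mat ` {A \<in> partial_perms n k. exc A = i}
      \<subseteq> {A \<in> partial_perms n k. wex A = n - k - i}"
    by (force simp: transpose_partial_perms)
  \<comment> \<open>Here \<open>i \<le> n - k\<close> ensures that \<open>n - k - i\<close> is a
    true difference, from which \<open>i\<close> can be recovered.\<close>
  have "exc (transpose_mat A) = i" if "A \<in> partial_perms n k" "wex A = n - k - i" for A
    using wex_add_exc_transpose_partial_perms[OF that(1)] that(2) assms by linarith
  then show "transpose_mat ` {A \<in> partial_perms n k. wex A = n - k - i}
      \<subseteq> {A \<in> partial_perms n k. exc A = i}"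
    by (auto simp: transpose_partial_perms)
qed auto

text \<open>Each monomial contributes 1 exactly when its exponent is \<open>m\<close>. This reduces
  the polynomial claim to the equality of cardinalities.\<close>

lemma coeff_sum_monom_1:
  assumes "finite S"
  shows "coeff (\<Sum>x\<in>S. monom (1 :: 'a :: comm_semiring_1) (f x)) m = of_nat (card {x \<in> S. f x = m})"
  using assms by (simp add: coeff_sum flip: sum.inter_filter)

theorem theorem4p1:
  fixes n k i :: nat
  assumes "1 \<le> i" and "i \<le> n - k"
  shows "card {A \<in> partial_perms n k. exc A = i} =
           card {A \<in> partial_perms n k. wex A = n - k - i} \<and>
         coeff (exc_poly n k) i = coeff (wex_poly n k) (n - k - i)"
  using card_exc_eq_card_wex[OF assms(2)]
  by (simp add: exc_poly_def wex_poly_def coeff_sum_monom_1 finite_partial_perms)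

end
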